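(* Let $\gamma>0$, let $S$ be a finite signal, $\rho$ an STL constraint, $n<|S|$, and let $v_{i,n}$ denote the $i$-th state variable (the $i$-th coordinate of $S_n$) at temporal position $n$. Regarding $R^*_{\gamma,S}(\rho,n)$ as a function of $v_{i,n}$ (all time indices and all other state variables held fixed), it is differentiable with respect to $v_{i,n}$ and $$\frac{d\big(R^*_{\gamma,S}(\rho,n)\big)}{d v_{i,n}} = dR^*_{\gamma,S}(\rho,n,v_{i,n}).$$
   Context: A signal $S$ consists of time indices $t_0<\dots<t_{|S|-1}$ and samples $S_0,\dots,S_{|S|-1}\in\mathbb{R}^m$; $v_{i,k}$ denotes the $i$-th coordinate of $S_k$. For $j<|S|-1$, $\Delta t_j=t_{j+1}-t_j$. STL constraints: $\rho ::= \mu_{f,c}\mid \neg\rho\mid \rho_1\wedge\rho_2\mid \square_{[x,y]}\rho\mid \Diamond_{[x,y]}\rho\mid \rho_1\,\mathcal{U}_{[x,y]}\,\rho_2$, with $f:\mathbb{R}^m\to\mathbb{R}$ differentiable and $c,x,y\in\mathbb{R}$. For $\gamma>0$: $\max_\gamma(a,b)=\gamma\ln(e^{a/\gamma}+e^{b/\gamma})$, $\min_\gamma(a,b)=-\max_\gamma(-a,-b)$. Their chain-rule derivatives: $\mathrm{dmax}_\gamma(a,da,b,db)=\dfrac{e^{a/\gamma}da+e^{b/\gamma}db}{e^{a/\gamma}+e^{b/\gamma}}$ and $\mathrm{dmin}_\gamma(a,da,b,db)=-\mathrm{dmax}_\gamma(-a,-da,-b,-db)$. Smooth robustness $R^*=R^*_{\gamma,S}(\rho,n)$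 for $n<|S|$ ("boundary" means $n=|S|-1$ or $y-\Delta t_n<0$): - $R^*(\mu_{f,c},n)=f(S_n)-c$; $R^*(\neg\rho,n)=-R^*(\rho,n)$; $R^*(\rho_1\wedge\rho_2,n)=\min_\gamma(R^*(\rho_1,n),R^*(\rho_2,n))$. - $R^*(\Diamond_{[x,y]}\rho,n)$: boundary: $\min_\gamma(-x,R^*(\rho,n))$; else $\max_\gamma\big(\min_\gamma(-x,R^*(\rho,n)),R^*(\Diamond_{[x-\Delta t_n,y-\Delta t_n]}\rho,n+1)\big)$. - $R^*(\square_{[x,y]}\rho,n)$: boundary: $\min_\gamma(-x,R^*(\rho,n))$; else $\min_\gamma\big(\max_\gamma(x,R^*(\rho,n)),R^*(\square_{[x-\Delta t_n,y-\Delta t_n]}\rho,n+1)\big)$. - $R^*(\rho_1\mathcal{U}_{[x,y]}\rho_2,n)$: boundary: $\min_\gamma(-x,R^*(\rho_1\wedge\rho_2,n))$; else $\max_\gamma\Big(\min_\gamma\big(\max_\gamma(x,R^*(\rho_1,n)),R^*(\rho_1\mathcal{U}_{[x-\Delta t_n,y-\Delta t_n]}\rho_2,n+1)\big),\min_\gamma(-x,R^*(\rho_1\wedge\rho_2,n))\Big)$. The function $dR^*_{\gamma,S}(\rho,n,v_{i,k})$ (written $dR^*(\rho,n)$, with $k,i$ fixed) is defined by the same recursion, applying the chain rule: $dR^*(\mu_{f,c},n)=\partial f/\partial(\text{coordinate }i)$ evaluated at $S_n$ if $n=k$, and $0$ otherwise; $dR^*(\neg\rho,n)=-dR^*(\rho,n)$;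 each occurrence of $\max_\gamma(a,b)$ (resp. $\min_\gamma(a,b)$) in the definition of $R^*$ is replaced by $\mathrm{dmax}_\gamma(a,da,b,db)$ (resp. $\mathrm{dmin}_\gamma(a,da,b,db)$), where $da,db$ are the corresponding $dR^*$ values of the arguments, the derivative of the constants $x$ and $-x$ being $0$. For example, for $\square_{[x,y]}\rho$ in the non-boundary case, $dR^*=\mathrm{dmin}_\gamma\big(\max_\gamma(x,R^*(\rho,n)),\ \mathrm{dmax}_\gamma(x,0,R^*(\rho,n),dR^*(\rho,n)),\ R^*(\square_{[x-\Delta t_n,y-\Delta t_n]}\rho,n+1),\ dR^*(\square_{[x-\Delta t_n,y-\Delta t_n]}\rho,n+1)\big)$, and in the boundary case $dR^*=\mathrm{dmin}_\gamma(-x,0,R^*(\rho,n),dR^*(\rho,n))$. *)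

theory Defs
  imports "HOL-Analysis.Analysis"
begin

text \<open>Signals are lists of pairs (time index, sample).\<close>

type_synonym 'm signal = "(real \<times> (real ^ 'm)) list"

definition is_signal :: "'m::finite signal \<Rightarrow> bool" where
  "is_signal S \<longleftrightarrow> sorted_wrt (<) (map fst S)"

definition time :: "'m::finite signal \<Rightarrow> nat \<Rightarrow> real" where
  "time S k = fst (S ! k)"

definition sample :: "'m::finite signal \<Rightarrow> nat \<Rightarrow> real ^ 'm" where
  "sample S k = snd (S ! k)"

definition delta_t :: "'m::finite signal \<Rightarrow> nat \<Rightarrow> real" where
  "delta_t S j = time S (Suc j) - time S j"

definition upd_coord :: "real ^ 'm \<Rightarrow> 'm::finite \<Rightarrow> real \<Rightarrow> real ^ 'm" where
  "upd_coord p i v = (\<chi> j. if j = i then v else p $ j)"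

definition upd_signal :: "'m::finite signal \<Rightarrow> nat \<Rightarrow> 'm \<Rightarrow> real \<Rightarrow> 'm signal" where
  "upd_signal S k i v = S[k := (time S k, upd_coord (sample S k) i v)]"

definition partial_deriv :: "(real ^ 'm \<Rightarrow> real) \<Rightarrow> 'm::finite \<Rightarrow> real ^ 'm \<Rightarrow> real" where
  "partial_deriv f i p = deriv (\<lambda>v. f (upd_coord p i v)) (p $ i)"

datatype ('m::finite) stl =
    Atom "real ^ 'm \<Rightarrow> real" real
  | Neg "'m stl"
  | Conj "'m stl" "'m stl"
  | Always real real "'m stl"
  | Eventually real real "'m stl"
  | Until real real "'m stl" "'m stl"

text \<open>The datatype admits arbitrary functions in atoms; STL constraints proper are those
  all of whose atoms are differentiable.\<close>

primrec is_stl :: "'m::finite stl \<Rightarrow> bool" where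
  "is_stl (Atom f c) \<longleftrightarrow> f differentiable_on UNIV"
| "is_stl (Neg \<rho>) \<longleftrightarrow> is_stl \<rho>"
| "is_stl (Conj \<rho>1 \<rho>2) \<longleftrightarrow> is_stl \<rho>1 \<and> is_stl \<rho>2"
| "is_stl (Always x y \<rho>) \<longleftrightarrow> is_stl \<rho>"
| "is_stl (Eventually x y \<rho>) \<longleftrightarrow> is_stl \<rho>"
| "is_stl (Until x y \<rho>1 \<rho>2) \<longleftrightarrow> is_stl \<rho>1 \<and> is_stl \<rho>2"

definition smax :: "real \<Rightarrow> real \<Rightarrow> real \<Rightarrow> real" where
  "smax \<gamma> a b = \<gamma> * ln (exp (a / \<gamma>) + exp (b / \<gamma>))"

definition smin :: "real \<Rightarrow> real \<Rightarrow> real \<Rightarrow> real" where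
  "smin \<gamma> a b = - smax \<gamma> (- a) (- b)"

definition dmax :: "real \<Rightarrow> real \<Rightarrow> real \<Rightarrow> real \<Rightarrow> real \<Rightarrow> real" where
  "dmax \<gamma> a da b db =
     (exp (a / \<gamma>) * da + exp (b / \<gamma>) * db) / (exp (a / \<gamma>) + exp (b / \<gamma>))"

definition dmin :: "real \<Rightarrow> real \<Rightarrow> real \<Rightarrow> real \<Rightarrow> real \<Rightarrow> real" where
  "dmin \<gamma> a da b db = - dmax \<gamma> (- a) (- da) (- b) (- db)"

text \<open>For \<open>n < length S\<close> the first disjunct says \<open>n = length S - 1\<close>; the inequality makes the
  recursions below terminate for all \<open>n\<close>.\<close>

definition boundary :: "'m::finite signal \<Rightarrow> nat \<Rightarrow> real \<Rightarrow> bool" where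
  "boundary S n y \<longleftrightarrow> length S \<le> Suc n \<or> y - delta_t S n < 0"

text \<open>Termination measure: \<open>Until\<close> has to weigh more than the conjunction of its arguments,
  which the library function \<open>size\<close> does not provide.\<close>

primrec weight :: "'m::finite stl \<Rightarrow> nat" where
  "weight (Atom f c) = 0"
| "weight (Neg \<rho>) = weight \<rho> + 1"
| "weight (Conj \<rho>1 \<rho>2) = weight \<rho>1 + weight \<rho>2 + 1"
| "weight (Always x y \<rho>) = weight \<rho> + 1"
| "weight (Eventually x y \<rho>) = weight \<rho> + 1"
| "weight (Until x y \<rho>1 \<rho>2) = weight \<rho>1 + weight \<rho>2 + 2"

function Rstar :: "real \<Rightarrow> 'm::finite signal \<Rightarrow> 'm stl \<Rightarrow> nat \<Rightarrow> real" where
  "Rstar \<gamma> S (Atom f c) n = f (sample S n) - c"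
| "Rstar \<gamma> S (Neg \<rho>) n = - Rstar \<gamma> S \<rho> n"
| "Rstar \<gamma> S (Conj \<rho>1 \<rho>2) n = smin \<gamma> (Rstar \<gamma> S \<rho>1 n) (Rstar \<gamma> S \<rho>2 n)"
| "Rstar \<gamma> S (Eventually x y \<rho>) n =
     (if boundary S n y then smin \<gamma> (- x) (Rstar \<gamma> S \<rho> n)
      else smax \<gamma>
             (smin \<gamma> (- x) (Rstar \<gamma> S \<rho> n))
             (Rstar \<gamma> S (Eventually (x - delta_t S n) (y - delta_t S n) \<rho>) (Suc n)))"
| "Rstar \<gamma> S (Always x y \<rho>) n =
     (if boundary S n y then smin \<gamma> (- x) (Rstar \<gamma> S \<rho> n)
      else smin \<gamma>
             (smax \<gamma> x (Rstar \<gamma> S \<rho> n))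
             (Rstar \<gamma> S (Always (x - delta_t S n) (y - delta_t S n) \<rho>) (Suc n)))"
| "Rstar \<gamma> S (Until x y \<rho>1 \<rho>2) n =
     (if boundary S n y then smin \<gamma> (- x) (Rstar \<gamma> S (Conj \<rho>1 \<rho>2) n)
      else smax \<gamma>
             (smin \<gamma>
               (smax \<gamma> x (Rstar \<gamma> S \<rho>1 n))
               (Rstar \<gamma> S (Until (x - delta_t S n) (y - delta_t S n) \<rho>1 \<rho>2) (Suc n)))
             (smin \<gamma> (- x) (Rstar \<gamma> S (Conj \<rho>1 \<rho>2) n)))"
  by pat_completeness auto
termination
  by (relation "measures [\<lambda>(\<gamma>, S, \<rho>, n). weight \<rho>, \<lambda>(\<gamma>, S, \<rho>, n). length S - n]")
    (auto simp: boundary_def)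

text \<open>\<open>dRstar \<gamma> S \<rho> n i k\<close> is the chain-rule derivative of \<open>Rstar \<gamma> S \<rho> n\<close> for
  coordinate \<open>i\<close> of sample \<open>k\<close>.\<close>

function dRstar ::
  "real \<Rightarrow> 'm::finite signal \<Rightarrow> 'm stl \<Rightarrow> nat \<Rightarrow> 'm \<Rightarrow> nat \<Rightarrow> real" where
  "dRstar \<gamma> S (Atom f c) n i k = (if n = k then partial_deriv f i (sample S n) else 0)"
| "dRstar \<gamma> S (Neg \<rho>) n i k = - dRstar \<gamma> S \<rho> n i k"
| "dRstar \<gamma> S (Conj \<rho>1 \<rho>2) n i k =
     dmin \<gamma> (Rstar \<gamma> S \<rho>1 n) (dRstar \<gamma> S \<rho>1 n i k)
            (Rstar \<gamma> S \<rho>2 n) (dRstar \<gamma> S \<rho>2 n i k)"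
| "dRstar \<gamma> S (Eventually x y \<rho>) n i k =
     (if boundary S n y then dmin \<gamma> (- x) 0 (Rstar \<gamma> S \<rho> n) (dRstar \<gamma> S \<rho> n i k)
      else dmax \<gamma>
             (smin \<gamma> (- x) (Rstar \<gamma> S \<rho> n))
             (dmin \<gamma> (- x) 0 (Rstar \<gamma> S \<rho> n) (dRstar \<gamma> S \<rho> n i k))
             (Rstar \<gamma> S (Eventually (x - delta_t S n) (y - delta_t S n) \<rho>) (Suc n))
             (dRstar \<gamma> S (Eventually (x - delta_t S n) (y - delta_t S n) \<rho>) (Suc n) i k))"
| "dRstar \<gamma> S (Always x y \<rho>) n i k =
     (if boundary S n y then dmin \<gamma> (- x) 0 (Rstar \<gamma> S \<rho> n) (dRstar \<gamma> S \<rho> n i k)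
      else dmin \<gamma>
             (smax \<gamma> x (Rstar \<gamma> S \<rho> n))
             (dmax \<gamma> x 0 (Rstar \<gamma> S \<rho> n) (dRstar \<gamma> S \<rho> n i k))
             (Rstar \<gamma> S (Always (x - delta_t S n) (y - delta_t S n) \<rho>) (Suc n))
             (dRstar \<gamma> S (Always (x - delta_t S n) (y - delta_t S n) \<rho>) (Suc n) i k))"
| "dRstar \<gamma> S (Until x y \<rho>1 \<rho>2) n i k =
     (if boundary S n y
      then dmin \<gamma> (- x) 0 (Rstar \<gamma> S (Conj \<rho>1 \<rho>2) n) (dRstar \<gamma> S (Conj \<rho>1 \<rho>2) n i k)
      else dmax \<gamma>
             (smin \<gamma>
               (smax \<gamma> x (Rstar \<gamma> S \<rho>1 n))
               (Rstar \<gamma> S (Until (x - delta_t S n) (y - delta_t S n) \<rho>1 \<rho>2) (Suc n)))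
             (dmin \<gamma>
               (smax \<gamma> x (Rstar \<gamma> S \<rho>1 n))
               (dmax \<gamma> x 0 (Rstar \<gamma> S \<rho>1 n) (dRstar \<gamma> S \<rho>1 n i k))
               (Rstar \<gamma> S (Until (x - delta_t S n) (y - delta_t S n) \<rho>1 \<rho>2) (Suc n))
               (dRstar \<gamma> S (Until (x - delta_t S n) (y - delta_t S n) \<rho>1 \<rho>2) (Suc n) i k))
             (smin \<gamma> (- x) (Rstar \<gamma> S (Conj \<rho>1 \<rho>2) n))
             (dmin \<gamma> (- x) 0
               (Rstar \<gamma> S (Conj \<rho>1 \<rho>2) n) (dRstar \<gamma> S (Conj \<rho>1 \<rho>2) n i k)))"
  by pat_completeness auto
termination
  by (relation "measures [\<lambda>(\<gamma>, S, \<rho>, n, i, k). weight \<rho>,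
                          \<lambda>(\<gamma>, S, \<rho>, n, i, k). length S - n]")
    (auto simp: boundary_def)

end

theory Submission
  imports Defs
begin

text \<open>Updating one coordinate of a sample leaves the time indices alone, so \<^const>\<open>boundary\<close> and
  \<^const>\<open>delta_t\<close> do not depend on \<open>v\<close>: every case distinction in the recursion is resolved
  identically for all \<open>v\<close>, and the derivative is obtained by the chain rule. The recursion
  advances \<open>n\<close>, so the induction needs the position \<open>k\<close> of the varied sample to be independent
  of \<open>n\<close>.\<close>

text \<open>Taking the values at \<open>a\<close> through the equations \<open>f a = u\<close> and
  \<open>g a = w\<close> lets \<open>u\<close> and \<open>w\<close> be the robustness values on
  \<open>S\<close> itself, as they occur in \<open>dRstar\<close>; \<open>upd_signal_self\<close>
  then settles the equations.\<close>

lemma smax_has_real_derivative: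
  assumes "\<gamma> \<noteq> 0"
    and f: "(f has_real_derivative f') (at a within A)" and "f a = u"
    and g: "(g has_real_derivative g') (at a within A)" and "g a = w"
  shows "((\<lambda>v. smax \<gamma> (f v) (g v)) has_real_derivative dmax \<gamma> u f' w g') (at a within A)"
proof -
  \<comment> \<open>The exponents contribute a factor \<open>1 / \<gamma>\<close>, which cancels
    against the \<open>\<gamma>\<close> in front of \<open>ln\<close>.\<close>
  have "((\<lambda>v. exp (f v / \<gamma>) + exp (g v / \<gamma>)) has_real_derivative
      (exp (u / \<gamma>) * f' + exp (w / \<gamma>) * g') / \<gamma>) (at a within A)"
    using assms(1,3,5) by (auto intro!: derivative_eq_intros f g simp: field_simps)
  moreover have "exp (f a / \<gamma>) + exp (g a / \<gamma>) > 0"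
    by (simp add: add_pos_pos)
  ultimately have "((\<lambda>v. \<gamma> * ln (exp (f v / \<gamma>) + exp (g v / \<gamma>))) has_real_derivative
      \<gamma> * (1 / (exp (f a / \<gamma>) + exp (g a / \<gamma>))
        * ((exp (u / \<gamma>) * f' + exp (w / \<gamma>) * g') / \<gamma>))) (at a within A)"
    by (intro DERIV_cmult DERIV_chain2[OF DERIV_ln_divide])
  then show ?thesis
    using assms(1,3,5) by (simp add: smax_def dmax_def)
qed

lemma smin_has_real_derivative:
  assumes "\<gamma> \<noteq> 0"
    and "(f has_real_derivative f') (at a within A)" and "f a = u"
    and "(g has_real_derivative g') (at a within A)" and "g a = w"
  shows "((\<lambda>v. smin \<gamma> (f v) (g v)) has_real_derivative dmin \<gamma> u f' w g') (at a within A)"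
  unfolding smin_def dmin_def
  by (intro DERIV_minus smax_has_real_derivative) (use assms in simp_all)

lemma upd_coord_self [simp]: "upd_coord p i (p $ i) = p"
  by (simp add: upd_coord_def vec_eq_iff)

text \<open>Since \<open>deriv\<close> is a choice operator, \<open>partial_deriv\<close> carries
  information only once the derivative exists; total differentiability of \<open>f\<close> ensures
  this along the line through \<open>p\<close> in direction \<open>i\<close>.\<close>

lemma upd_coord_has_partial_deriv:
  assumes "f differentiable_on UNIV"
  shows "((\<lambda>v. f (upd_coord p i v)) has_real_derivative partial_deriv f i p) (at (p $ i))"
proof -
  have affine: "upd_coord p i = (\<lambda>v. p + (v - p $ i) *\<^sub>R axis i 1)"
    by (auto simp: upd_coord_def vec_eq_iff axis_def)
  have "upd_coord p i differentiable at (p $ i)"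
    unfolding affine by (intro derivative_intros)
  moreover have "f differentiable at (upd_coord p i (p $ i))"
    using assms by (simp add: differentiable_on_def)
  ultimately have "(\<lambda>v. f (upd_coord p i v)) differentiable at (p $ i)"
    using differentiable_chain_at[of "upd_coord p i" "p $ i" f] by (simp add: o_def)
  then show ?thesis
    unfolding partial_deriv_def
    by (simp add: DERIV_deriv_iff_real_differentiable)
qed

lemma length_upd_signal [simp]: "length (upd_signal S k i v) = length S"
  by (simp add: upd_signal_def)

lemma upd_signal_self [simp]: "upd_signal S k i (sample S k $ i) = S"
  by (simp add: upd_signal_def time_def sample_def)

lemma sample_upd_signal:
  assumes "n < length S"
  shows "sample (upd_signal S k i v) n
    = (if n = k then upd_coord (sample S k) i v else sample S n)"
  using assms by (simp add: sample_def upd_signal_def nth_list_update)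

lemma time_upd_signal: "n < length S \<Longrightarrow> time (upd_signal S k i v) n = time S n"
  by (cases "n = k") (simp_all add: time_def upd_signal_def)

lemma delta_t_upd_signal: "Suc n < length S \<Longrightarrow> delta_t (upd_signal S k i v) n = delta_t S n"
  by (simp add: delta_t_def time_upd_signal)

text \<open>At the last position \<open>delta_t\<close> reads past the end of the list, but there
  the length test alone decides, so no bound on \<open>n\<close> is required.\<close>

lemma boundary_upd_signal [simp]: "boundary (upd_signal S k i v) n y = boundary S n y"
  by (cases "length S \<le> Suc n") (simp_all add: boundary_def delta_t_upd_signal)

lemma not_boundaryD: "\<not> boundary S n y \<Longrightarrow> Suc n < length S"
  by (simp add: boundary_def)

lemma Rstar_has_real_derivative:
  assumes "\<gamma> > 0" and "is_stl \<rho>" and "n < length S"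
  shows "((\<lambda>v. Rstar \<gamma> (upd_signal S k i v) \<rho> n) has_real_derivative dRstar \<gamma> S \<rho> n i k)
           (at (sample S k $ i))"
  using assms
proof (induction \<gamma> S \<rho> n rule: Rstar.induct)
  case (1 \<gamma> S f c n)
  show ?case
  proof (cases "n = k")
    case True
    have "((\<lambda>v. f (upd_coord (sample S k) i v) - c) has_real_derivative
        partial_deriv f i (sample S k) - 0) (at (sample S k $ i))"
      using 1 by (intro DERIV_diff upd_coord_has_partial_deriv DERIV_const) simp
    with True 1 show ?thesis by (simp add: sample_upd_signal)
  next
    \<comment> \<open>The atom reads only sample \<open>n\<close>, which the update leaves alone:
      the function is constant in \<open>v\<close>.\<close>
    case False
    with 1 show ?thesis by (simp add: sample_upd_signal)
  qed
next
  case (2 \<gamma> S \<rho> n)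
  then show ?case by (auto intro: DERIV_minus)
next
  case (3 \<gamma> S \<rho>1 \<rho>2 n)
  then show ?case by (auto intro!: smin_has_real_derivative)
next
  case (4 \<gamma> S x y \<rho> n)
  note [simp del] = Rstar.simps dRstar.simps
  note unfold = Rstar.simps(4) dRstar.simps(4)
  show ?case
  proof (cases "boundary S n y")
    case True
    with 4 show ?thesis
      by (simp add: unfold smin_has_real_derivative)
  next
    case False
    \<comment> \<open>In this range \<open>delta_t\<close> is the same for all \<open>v\<close>, so
      the recursive call keeps one shifted interval and its induction hypothesis applies.\<close>
    then have "Suc n < length S" by (rule not_boundaryD)
    with False 4 show ?thesis
      by (simp add: unfold delta_t_upd_signal smin_has_real_derivative smax_has_real_derivative)
  qed
next
  case (5 \<gamma> S x y \<rho> n)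
  note [simp del] = Rstar.simps dRstar.simps
  note unfold = Rstar.simps(5) dRstar.simps(5)
  show ?case
  proof (cases "boundary S n y")
    case True
    with 5 show ?thesis
      by (simp add: unfold smin_has_real_derivative)
  next
    case False
    then have "Suc n < length S" by (rule not_boundaryD)
    with False 5 show ?thesis
      by (simp add: unfold delta_t_upd_signal smin_has_real_derivative smax_has_real_derivative)
  qed
next
  case (6 \<gamma> S x y \<rho>1 \<rho>2 n)
  \<comment> \<open>The recursion calls the conjunction as a formula, so \<open>Rstar.induct\<close>
    has a hypothesis for it; the \<open>Conj\<close> equations stay out of the simpset to keep that
    term folded and matching.\<close>
  note [simp del] = Rstar.simps dRstar.simps
  note unfold = Rstar.simps(6) dRstar.simps(6)
  show ?case
  proof (cases "boundary S n y")
    case True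
    with 6 show ?thesis
      by (simp add: unfold smin_has_real_derivative)
  next
    case False
    then have "Suc n < length S" by (rule not_boundaryD)
    with False 6 show ?thesis
      by (simp add: unfold delta_t_upd_signal smin_has_real_derivative smax_has_real_derivative)
  qed
qed

theorem theorem2:
  fixes \<gamma> :: real and S :: "'m::finite signal" and \<rho> :: "'m stl" and n :: nat and i :: 'm
  assumes "\<gamma> > 0"
    and "is_signal S"
    and "is_stl \<rho>"
    and "n < length S"
  shows "((\<lambda>v. Rstar \<gamma> (upd_signal S n i v) \<rho> n) has_real_derivative dRstar \<gamma> S \<rho> n i n)
           (at (sample S n $ i))"
  using assms(1,3,4) by (rule Rstar_has_real_derivative)

end
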